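(* Assume there exists a feasible point $M$ of the problem (P) described in the context such that $(M_t)_{ij}>0$ whenever $(A_t)_{ij}>0$ (for all $t,i,j$). Let $(\lambda,\nu)$ be dual optimal for (P) (see context), let $u_t=\exp(C^\top\lambda_t)$ for $0\le t\le T$, $w_t=\exp(\nu_t)$ for $1\le t\le T-1$, $w_0=\mathbf 1$, $w_T=u_T$, and $\mathcal A_t=\operatorname{diag}(u_t\oslash w_t)A_t\operatorname{diag}(w_{t+1})$ for $0\le t\le T-1$. Then the linear time-varying system $$\mu_{t+1}=\mathcal A_t^\top\mu_t,\qquad \rho_t=C\mu_t$$ is ($(T+1)$-step) observable if and only if the system $$\mu_{t+1}=A_t^\top\mu_t,\qquad \rho_t=C\mu_t$$ is ($(T+1)$-step) observable. Moreover, the unobservable subspaces of the two systems coincide.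
   Context: Setting. Let $n,T\ge1$ be integers and let $A_0,\dots,A_{T-1}\in\mathbb{R}^{n\times n}_{\ge0}$ be row-stochastic matrices ($A_t\mathbf 1=\mathbf 1$). Let $\pi=\{\pi_1,\dots,\pi_k\}\subseteq\{1,\dots,n\}$ have $k$ elements and let $C=[e_{\pi_1},\dots,e_{\pi_k}]^\top\in\{0,1\}^{k\times n}$ be the coordinate-selection matrix of $\pi$. Let $\rho_0,\dots,\rho_T\in\mathbb{R}^k$ be given. Notation. $\mathbf 1$ is the all-ones vector; $\odot,\oslash,\exp$ are entrywise; $\operatorname{supp}$ is the set of positions of nonzero entries. For nonnegative arrays $p,q$ of the same size with $\operatorname{supp}(p)\subseteq\operatorname{supp}(q)$, $\mathcal D(p\,|\,q)=\sum_i\big(p_i\log(p_i/q_i)-p_i+q_i\big)$, with $0\log 0:=0$ (terms with $p_i=q_i=0$ are $0$). Problem (P): minimize $\sum_{t=0}^{T-1}\mathcal D\big(M_t\,|\,\operatorname{diag}(M_t\mathbf 1)A_t\big)$ over $M_0,\dots,M_{T-1}\in\mathbb{R}^{n\times n}_{\ge0}$ with $\operatorname{supp}(M_t)\subseteq\operatorname{supp}(A_t)$, subject to (i) $CM_t\mathbf 1=\rho_t$ for $t=0,\dots,T-1$; (ii) $CM_{T-1}^\top\mathbf 1=\rho_T$; (iii) $M_t\mathbf 1=M_{t-1}^\top\mathbf 1$ for $t=1,\dots,T-1$. Dual optimality: $(\lambda,\nu)$, with $\lambda_t\in\mathbb{R}^k$ ($0\le t\le T$) and $\nu_t\in\mathbb{R}^n$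 ($1\le t\le T-1$), is dual optimal if it maximizes $\sum_{t=0}^T\lambda_t^\top\rho_t$ subject to $u_t\odot(A_tw_{t+1})\le w_t$ for $t=0,\dots,T-1$, where $u_t=\exp(C^\top\lambda_t)$, $w_t=\exp(\nu_t)$ for $1\le t\le T-1$, $w_0=\mathbf 1$, $w_T=u_T$ (this is the Lagrangian dual of (P), with $\lambda$ the multipliers of (i),(ii) and $\nu$ those of (iii)). Observability: for matrices $B_0,\dots,B_{T-1}\in\mathbb{R}^{n\times n}$, the unobservable subspace of the system $\mu_{t+1}=B_t^\top\mu_t$, output $C\mu_t$, over times $0,\dots,T$ is $\{x\in\mathbb{R}^n: Cx=0,\ CB_{t-1}^\top\cdots B_0^\top x=0\ \text{for } t=1,\dots,T\}$; the system is ($(T+1)$-step) observable if this subspace is $\{0\}$, i.e. the initial state is uniquely determined by the outputs at times $0,\dots,T$. *)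

theory Defs
  imports Complex_Main "Jordan_Normal_Form.Matrix"
begin

(* Coordinates are numbered from 0. Families indexed by time are functions on nat; only the
   entries at the times stated in each definition matter. *)

definition ones_vec :: "nat \<Rightarrow> real vec" where
  "ones_vec n = vec n (\<lambda>_. 1)"

definition row_stochastic :: "nat \<Rightarrow> real mat \<Rightarrow> bool" where
  "row_stochastic n A \<longleftrightarrow> A \<in> carrier_mat n n \<and> (\<forall>i<n. \<forall>j<n. 0 \<le> A $$ (i, j))
     \<and> A *\<^sub>v ones_vec n = ones_vec n"

definition selection_mat :: "nat \<Rightarrow> nat \<Rightarrow> (nat \<Rightarrow> nat) \<Rightarrow> real mat" where
  "selection_mat n k \<pi> = (mat_of_cols n (map (\<lambda>i. unit_vec n (\<pi> i)) [0..<k]))\<^sup>T"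

(* The feasible set of the problem of minimising the sum over t < T of
   D(M_t | diag(M_t 1) A_t), where D(p|q) is the sum of p log (p/q) - p + q. The support condition
   below makes every term of the objective well defined, so the objective adds no constraint. *)
definition primal_feasible ::
  "nat \<Rightarrow> nat \<Rightarrow> real mat \<Rightarrow> (nat \<Rightarrow> real mat) \<Rightarrow> (nat \<Rightarrow> real vec) \<Rightarrow> (nat \<Rightarrow> real mat) \<Rightarrow> bool" where
  "primal_feasible n T C A \<rho> M \<longleftrightarrow>
     (\<forall>t<T. M t \<in> carrier_mat n n
        \<and> (\<forall>i<n. \<forall>j<n. 0 \<le> M t $$ (i, j) \<and> (M t $$ (i, j) \<noteq> 0 \<longrightarrow> A t $$ (i, j) \<noteq> 0)))
     \<and> (\<forall>t<T. C *\<^sub>v (M t *\<^sub>v ones_vec n) = \<rho> t)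
     \<and> C *\<^sub>v ((M (T - 1))\<^sup>T *\<^sub>v ones_vec n) = \<rho> T
     \<and> (\<forall>t\<in>{1..<T}. M t *\<^sub>v ones_vec n = (M (t - 1))\<^sup>T *\<^sub>v ones_vec n)"

definition u_vec :: "real mat \<Rightarrow> (nat \<Rightarrow> real vec) \<Rightarrow> nat \<Rightarrow> real vec" where
  "u_vec C l t = map_vec exp (C\<^sup>T *\<^sub>v l t)"

definition w_vec ::
  "nat \<Rightarrow> nat \<Rightarrow> real mat \<Rightarrow> (nat \<Rightarrow> real vec) \<Rightarrow> (nat \<Rightarrow> real vec) \<Rightarrow> nat \<Rightarrow> real vec" where
  "w_vec n T C l \<nu> t =
     (if t = 0 then ones_vec n else if t = T then u_vec C l T else map_vec exp (\<nu> t))"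

definition dual_feasible ::
  "nat \<Rightarrow> nat \<Rightarrow> nat \<Rightarrow> real mat \<Rightarrow> (nat \<Rightarrow> real mat) \<Rightarrow> (nat \<Rightarrow> real vec) \<Rightarrow> (nat \<Rightarrow> real vec) \<Rightarrow> bool" where
  "dual_feasible n T k C A l \<nu> \<longleftrightarrow>
     (\<forall>t\<le>T. l t \<in> carrier_vec k) \<and> (\<forall>t\<in>{1..<T}. \<nu> t \<in> carrier_vec n)
     \<and> (\<forall>t<T. \<forall>i<n. u_vec C l t $ i * (A t *\<^sub>v w_vec n T C l \<nu> (Suc t)) $ i \<le> w_vec n T C l \<nu> t $ i)"

definition dual_objective :: "nat \<Rightarrow> (nat \<Rightarrow> real vec) \<Rightarrow> (nat \<Rightarrow> real vec) \<Rightarrow> real" where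
  "dual_objective T \<rho> l = (\<Sum>t\<le>T. l t \<bullet> \<rho> t)"

definition dual_optimal ::
  "nat \<Rightarrow> nat \<Rightarrow> nat \<Rightarrow> real mat \<Rightarrow> (nat \<Rightarrow> real mat) \<Rightarrow> (nat \<Rightarrow> real vec) \<Rightarrow>
   (nat \<Rightarrow> real vec) \<Rightarrow> (nat \<Rightarrow> real vec) \<Rightarrow> bool" where
  "dual_optimal n T k C A \<rho> l \<nu> \<longleftrightarrow>
     dual_feasible n T k C A l \<nu>
     \<and> (\<forall>l' \<nu>'. dual_feasible n T k C A l' \<nu>' \<longrightarrow> dual_objective T \<rho> l' \<le> dual_objective T \<rho> l)"

definition scaled_mat ::
  "nat \<Rightarrow> nat \<Rightarrow> real mat \<Rightarrow> (nat \<Rightarrow> real mat) \<Rightarrow> (nat \<Rightarrow> real vec) \<Rightarrow> (nat \<Rightarrow> real vec) \<Rightarrow> nat \<Rightarrow> real mat" where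
  "scaled_mat n T C A l \<nu> t =
     mat_diag n (\<lambda>i. u_vec C l t $ i / w_vec n T C l \<nu> t $ i) * A t
       * mat_diag n (\<lambda>i. w_vec n T C l \<nu> (Suc t) $ i)"

(* The product B_{t-1}^T ... B_0^T, which maps the state at time 0 to the state at time t. *)
primrec transition_mat :: "nat \<Rightarrow> (nat \<Rightarrow> real mat) \<Rightarrow> nat \<Rightarrow> real mat" where
  "transition_mat n B 0 = 1\<^sub>m n"
| "transition_mat n B (Suc t) = (B t)\<^sup>T * transition_mat n B t"

definition unobservable_subspace ::
  "nat \<Rightarrow> nat \<Rightarrow> nat \<Rightarrow> real mat \<Rightarrow> (nat \<Rightarrow> real mat) \<Rightarrow> real vec set" where
  "unobservable_subspace n T k C B =
     {x \<in> carrier_vec n. C *\<^sub>v x = 0\<^sub>v k \<and> (\<forall>t\<in>{1..T}. (C * transition_mat n B t) *\<^sub>v x = 0\<^sub>v k)}"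

definition observable ::
  "nat \<Rightarrow> nat \<Rightarrow> nat \<Rightarrow> real mat \<Rightarrow> (nat \<Rightarrow> real mat) \<Rightarrow> bool" where
  "observable n T k C B \<longleftrightarrow> unobservable_subspace n T k C B = {0\<^sub>v n}"

end

(* A state with zero output vanishes on the selected coordinates, and u_t = 1 on all the others.
   So as long as the outputs vanish, a step of the scaled system is a step of the original one
   conjugated by diag w: the scaled state is diag w_t times the original state. As w_0 = 1 and
   w_t > 0, both systems start in the same state and their outputs vanish together. *)

theory Submission
  imports Defs
begin

section \<open>Coordinate selection and the weights \<open>u\<close> and \<open>w\<close>\<close>

lemma selection_mat_carrier: "selection_mat n k \<pi> \<in> carrier_mat k n"
  by (auto simp: selection_mat_def)

lemma selection_mat_index:
  assumes "i < k" "j < n" "\<pi> i < n"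
  shows "selection_mat n k \<pi> $$ (i, j) = (if j = \<pi> i then 1 else 0)"
  using assms by (auto simp: selection_mat_def mat_of_cols_def)

lemma selection_mat_mult_vec_index:
  assumes "\<pi> ` {..<k} \<subseteq> {..<n}" "v \<in> carrier_vec n" "i < k"
  shows "(selection_mat n k \<pi> *\<^sub>v v) $ i = v $ \<pi> i"
proof -
  have "\<pi> i < n" using assms by auto
  then have "row (selection_mat n k \<pi>) i = unit_vec n (\<pi> i)"
    using assms selection_mat_carrier[of n k \<pi>]
    by (intro eq_vecI) (auto simp: selection_mat_index unit_vec_def)
  then show ?thesis
    using assms \<open>\<pi> i < n\<close> selection_mat_carrier[of n k \<pi>] by auto
qed

lemma selection_mat_mult_vec_eq_0_iff:
  assumes "\<pi> ` {..<k} \<subseteq> {..<n}" "v \<in> carrier_vec n"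
  shows "selection_mat n k \<pi> *\<^sub>v v = 0\<^sub>v k \<longleftrightarrow> (\<forall>i<k. v $ \<pi> i = 0)"
  using selection_mat_mult_vec_index[OF assms] selection_mat_carrier[of n k \<pi>]
  by (auto simp: vec_eq_iff simp del: index_mult_mat_vec)

text \<open>Column \<open>j\<close> of the selection matrix is zero off the selected coordinates, so
  the exponent at \<open>j\<close> is an empty combination of multipliers and \<open>exp\<close>
  turns it into 1.\<close>

lemma u_vec_unselected:
  assumes "\<pi> ` {..<k} \<subseteq> {..<n}" "l t \<in> carrier_vec k" "j < n" "j \<notin> \<pi> ` {..<k}"
  shows "u_vec (selection_mat n k \<pi>) l t $ j = 1"
proof -
  have "col (selection_mat n k \<pi>) j = 0\<^sub>v k"
    using assms selection_mat_carrier[of n k \<pi>]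
    by (intro eq_vecI) (auto simp: selection_mat_index image_subset_iff)
  then show ?thesis
    using assms selection_mat_carrier[of n k \<pi>] by (simp add: u_vec_def)
qed

text \<open>Each branch of \<open>w_vec\<close> is the constant 1 or an exponential. The carrier
  conditions place \<open>i\<close> inside the vector, so that \<open>map_vec exp\<close> can be
  evaluated there.\<close>

lemma w_vec_pos:
  assumes "C \<in> carrier_mat k n" "\<forall>t\<in>{1..<T}. \<nu> t \<in> carrier_vec n" "t \<le> T" "i < n"
  shows "w_vec n T C l \<nu> t $ i > 0"
proof -
  consider "t = 0" | "t = T" | "t \<in> {1..<T}"
    using \<open>t \<le> T\<close> by force
  then show ?thesis
  proof cases
    case 3
    then have "dim_vec (\<nu> t) = n" using assms(2) by auto
    with 3 \<open>i < n\<close> show ?thesis by (simp add: w_vec_def)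
  qed (use assms in \<open>simp_all add: w_vec_def ones_vec_def u_vec_def\<close>)
qed

section \<open>Diagonal matrices, transition matrices and the transposed scaled step\<close>

lemma mat_diag_mult_vec_index:
  fixes v :: "'a::semiring_1 vec"
  assumes "v \<in> carrier_vec n" "i < n"
  shows "(mat_diag n f *\<^sub>v v) $ i = f i * v $ i"
proof -
  have "(mat_diag n f *\<^sub>v v) $ i = (\<Sum>j\<in>{0..<n}. (if i = j then f j else 0) * v $ j)"
    using assms by (simp add: mat_diag_def scalar_prod_def)
  also have "\<dots> = (\<Sum>j\<in>{0..<n}. if j = i then f i * v $ i else 0)"
    by (rule sum.cong) auto
  also have "\<dots> = f i * v $ i" using assms by simp
  finally show ?thesis .
qed

lemma transpose_mat_diag: "(mat_diag n f)\<^sup>T = mat_diag n f"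
  by (rule eq_matI) (auto simp: mat_diag_def)

lemma transition_mat_carrier:
  "(\<And>s. s < t \<Longrightarrow> B s \<in> carrier_mat n n) \<Longrightarrow> transition_mat n B t \<in> carrier_mat n n"
  by (induction t) (auto intro!: mult_carrier_mat[of _ n n])

text \<open>Brings the subspace into the form suited to induction on time: time 0 joins the other
  times, since its transition matrix is the identity, and reassociating exposes the state at time
  \<open>t\<close> as a vector.\<close>

lemma unobservable_subspace_eq:
  assumes "C \<in> carrier_mat k n" "\<And>t. t < T \<Longrightarrow> B t \<in> carrier_mat n n"
  shows "unobservable_subspace n T k C B =
    {x \<in> carrier_vec n. \<forall>t\<le>T. C *\<^sub>v (transition_mat n B t *\<^sub>v x) = 0\<^sub>v k}"
proof -
  have assoc: "(C * transition_mat n B t) *\<^sub>v x = C *\<^sub>v (transition_mat n B t *\<^sub>v x)"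
    if "t \<le> T" "x \<in> carrier_vec n" for t x
  proof (rule assoc_mult_mat_vec)
    show "transition_mat n B t \<in> carrier_mat n n"
      using assms(2) that(1) by (simp add: transition_mat_carrier)
  qed (use assms(1) that in auto)
  have "C *\<^sub>v x = 0\<^sub>v k \<and> (\<forall>t\<in>{1..T}. (C * transition_mat n B t) *\<^sub>v x = 0\<^sub>v k) \<longleftrightarrow>
      (\<forall>t\<le>T. C *\<^sub>v (transition_mat n B t *\<^sub>v x) = 0\<^sub>v k)" (is "?L \<longleftrightarrow> ?R")
    if x: "x \<in> carrier_vec n" for x
  proof
    assume L: ?L
    show ?R
    proof (intro allI impI)
      fix t assume "t \<le> T"
      then show "C *\<^sub>v (transition_mat n B t *\<^sub>v x) = 0\<^sub>v k"
        using L x assoc[of t x] by (cases "t = 0") auto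
    qed
  next
    assume R: ?R
    then have "C *\<^sub>v x = 0\<^sub>v k" using x by (auto dest: spec[of _ 0])
    with R x show ?L by (simp add: assoc)
  qed
  then show ?thesis
    by (auto simp only: unobservable_subspace_def)
qed

lemma scaled_mat_carrier: "A t \<in> carrier_mat n n \<Longrightarrow> scaled_mat n T C A l \<nu> t \<in> carrier_mat n n"
  by (simp add: scaled_mat_def mult_carrier_mat[of _ n n])

text \<open>Transposition reverses the three factors and fixes the diagonal ones, so the scaling by
  \<open>u_t / w_t\<close> acts on the state first and the scaling by \<open>w_(t+1)\<close>
  last.\<close>

lemma transpose_scaled_mat_mult_vec:
  assumes "A t \<in> carrier_mat n n" "v \<in> carrier_vec n"
  shows "(scaled_mat n T C A l \<nu> t)\<^sup>T *\<^sub>v v =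
    mat_diag n (\<lambda>i. w_vec n T C l \<nu> (Suc t) $ i) *\<^sub>v
      ((A t)\<^sup>T *\<^sub>v (mat_diag n (\<lambda>i. u_vec C l t $ i / w_vec n T C l \<nu> t $ i) *\<^sub>v v))"
proof -
  define D where "D = mat_diag n (\<lambda>i. u_vec C l t $ i / w_vec n T C l \<nu> t $ i)"
  define W where "W = mat_diag n (\<lambda>i. w_vec n T C l \<nu> (Suc t) $ i)"
  have D: "D \<in> carrier_mat n n" and W: "W \<in> carrier_mat n n"
    by (simp_all add: D_def W_def)
  have "(D * A t * W)\<^sup>T = W * ((A t)\<^sup>T * D)"
    using D W assms by (simp add: transpose_mult[of _ n n _ n])
      (simp add: D_def W_def transpose_mat_diag)
  also have "\<dots> *\<^sub>v v = W *\<^sub>v ((A t)\<^sup>T *\<^sub>v (D *\<^sub>v v))"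
    using D W assms by (simp add: assoc_mult_mat_vec[of _ n n _ n])
  finally show ?thesis
    by (simp add: scaled_mat_def D_def W_def)
qed

section \<open>Comparison of the scaled and the original system\<close>

context
  fixes n T k :: nat and A :: "nat \<Rightarrow> real mat" and \<pi> :: "nat \<Rightarrow> nat" and C :: "real mat"
    and l \<nu> :: "nat \<Rightarrow> real vec"
  assumes A: "\<And>t. t < T \<Longrightarrow> A t \<in> carrier_mat n n"
    and \<pi>: "\<pi> ` {..<k} \<subseteq> {..<n}"
    and C_def: "C = selection_mat n k \<pi>"
    and l: "\<And>t. t < T \<Longrightarrow> l t \<in> carrier_vec k"
    and \<nu>: "\<forall>t\<in>{1..<T}. \<nu> t \<in> carrier_vec n"
begin

private abbreviation (input) "S \<equiv> scaled_mat n T C A l \<nu>"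
private abbreviation (input) "W t \<equiv> mat_diag n (\<lambda>i. w_vec n T C l \<nu> t $ i)"

private lemma C: "C \<in> carrier_mat k n"
  by (simp add: C_def selection_mat_carrier)

private lemma S: "t < T \<Longrightarrow> S t \<in> carrier_mat n n"
  by (simp add: A scaled_mat_carrier)

text \<open>The first scaling of the transposed step, by \<open>u_t / w_t\<close>, cancels
  \<open>W t\<close> as soon as \<open>u_t\<close> acts as the identity on \<open>y\<close>, which
  the zero output guarantees.\<close>

lemma scaled_step:
  assumes "t < T" "y \<in> carrier_vec n" "C *\<^sub>v y = 0\<^sub>v k"
  shows "(S t)\<^sup>T *\<^sub>v (W t *\<^sub>v y) = W (Suc t) *\<^sub>v ((A t)\<^sup>T *\<^sub>v y)"
proof -
  have W: "W t *\<^sub>v y \<in> carrier_vec n"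
    by (rule mult_mat_vec_carrier[of _ n n]) (use assms in auto)
  have "mat_diag n (\<lambda>i. u_vec C l t $ i / w_vec n T C l \<nu> t $ i) *\<^sub>v (W t *\<^sub>v y) = y" 
    (is "?D *\<^sub>v _ = _")
  proof (rule eq_vecI)
    fix i assume "i < dim_vec y"
    then have i: "i < n" using assms by simp
    have "w_vec n T C l \<nu> t $ i \<noteq> 0"
      using w_vec_pos[OF C \<nu> _ i, of t l] assms by (metis less_imp_le less_irrefl)
    \<comment> \<open>On a selected coordinate both sides vanish, because \<open>y\<close> does; on
      any other coordinate the factor is 1.\<close>
    moreover have "u_vec C l t $ i * y $ i = y $ i"
    proof (cases "i \<in> \<pi> ` {..<k}")
      case True
      then show ?thesis
        using assms selection_mat_mult_vec_eq_0_iff[OF \<pi>] by (auto simp: C_def)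
    next
      case False
      then show ?thesis
        using u_vec_unselected[where \<pi> = \<pi>, OF \<pi> l i] assms by (simp add: C_def)
    qed
    ultimately show "(?D *\<^sub>v (W t *\<^sub>v y)) $ i = y $ i"
      using W i assms by (simp add: mat_diag_mult_vec_index del: index_mult_mat_vec)
  qed (use assms in \<open>simp add: mat_diag_def\<close>)
  then show ?thesis
    using transpose_scaled_mat_mult_vec[OF A W] assms by simp
qed

text \<open>Induction on time. The strict bound \<open>s < t\<close> matters: the step into time
  \<open>t\<close> uses the output at the previous time, so the relation holds at \<open>t\<close>
  before anything is known about the output at \<open>t\<close> itself.\<close>

lemma scaled_transition:
  assumes "x \<in> carrier_vec n" "t \<le> T" "\<And>s. s < t \<Longrightarrow> C *\<^sub>v (transition_mat n A s *\<^sub>v x) = 0\<^sub>v k"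
  shows "transition_mat n S t *\<^sub>v x = W t *\<^sub>v (transition_mat n A t *\<^sub>v x)"
  using assms(2,3)
proof (induction t)
  case 0
  \<comment> \<open>The convention that \<open>w_0\<close> is the all-ones vector makes the two
    initial states equal.\<close>
  have "W 0 = 1\<^sub>m n"
    by (rule eq_matI) (auto simp: mat_diag_def w_vec_def ones_vec_def)
  with assms(1) show ?case by simp
next
  case (Suc t)
  have tA: "transition_mat n A t \<in> carrier_mat n n" and tS: "transition_mat n S t \<in> carrier_mat n n"
    using Suc.prems A S by (auto intro!: transition_mat_carrier)
  have y: "transition_mat n A t *\<^sub>v x \<in> carrier_vec n"
    using tA assms(1) by simp
  have "transition_mat n S (Suc t) *\<^sub>v x = (S t)\<^sup>T *\<^sub>v (transition_mat n S t *\<^sub>v x)"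
    using tS S[of t] Suc.prems assms(1) by (simp add: assoc_mult_mat_vec[of _ n n _ n])
  also have "\<dots> = (S t)\<^sup>T *\<^sub>v (W t *\<^sub>v (transition_mat n A t *\<^sub>v x))"
    using Suc by simp
  also have "\<dots> = W (Suc t) *\<^sub>v ((A t)\<^sup>T *\<^sub>v (transition_mat n A t *\<^sub>v x))"
    using Suc.prems y by (intro scaled_step) auto
  also have "\<dots> = W (Suc t) *\<^sub>v (transition_mat n A (Suc t) *\<^sub>v x)"
    using tA A[of t] Suc.prems assms(1) by (simp add: assoc_mult_mat_vec[of _ n n _ n])
  finally show ?case .
qed

text \<open>By \<open>scaled_transition\<close> the two states differ by a diagonal matrix with
  positive entries, which does not change which coordinates vanish, in particular among the selected
  ones.\<close>

lemma scaled_output_eq_0_iff: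
  assumes "x \<in> carrier_vec n" "t \<le> T" "\<And>s. s < t \<Longrightarrow> C *\<^sub>v (transition_mat n A s *\<^sub>v x) = 0\<^sub>v k"
  shows "C *\<^sub>v (transition_mat n S t *\<^sub>v x) = 0\<^sub>v k \<longleftrightarrow> C *\<^sub>v (transition_mat n A t *\<^sub>v x) = 0\<^sub>v k"
proof -
  define y where "y = transition_mat n A t *\<^sub>v x"
  have y: "y \<in> carrier_vec n"
    unfolding y_def using assms A
    by (intro mult_mat_vec_carrier[of _ n n] transition_mat_carrier) auto
  then have Wy: "W t *\<^sub>v y \<in> carrier_vec n"
    by (intro mult_mat_vec_carrier[of _ n n]) auto
  have "(W t *\<^sub>v y) $ \<pi> i = 0 \<longleftrightarrow> y $ \<pi> i = 0" if "i < k" for i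
  proof -
    have "\<pi> i < n" using \<pi> that by auto
    then show ?thesis
      using w_vec_pos[OF C \<nu> \<open>t \<le> T\<close>, of "\<pi> i" l] y
      by (simp add: mat_diag_mult_vec_index del: index_mult_mat_vec)
  qed
  then have "C *\<^sub>v (W t *\<^sub>v y) = 0\<^sub>v k \<longleftrightarrow> C *\<^sub>v y = 0\<^sub>v k"
    using selection_mat_mult_vec_eq_0_iff[OF \<pi>] y Wy by (simp add: C_def)
  then show ?thesis
    using scaled_transition[OF assms] by (simp add: y_def)
qed

lemma unobservable_subspace_scaled_mat:
  "unobservable_subspace n T k C S = unobservable_subspace n T k C A"
proof -
  have "(\<forall>t\<le>T. C *\<^sub>v (transition_mat n S t *\<^sub>v x) = 0\<^sub>v k) \<longleftrightarrow>
        (\<forall>t\<le>T. C *\<^sub>v (transition_mat n A t *\<^sub>v x) = 0\<^sub>v k)" (is "?L \<longleftrightarrow> ?R")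
    if x: "x \<in> carrier_vec n" for x
  proof
    assume L: ?L
    \<comment> \<open>The equivalence at time \<open>t\<close> presupposes zero outputs of the
      original system at all earlier times. Here only the scaled outputs are known to vanish, so
      strong induction supplies them.\<close>
    have "t \<le> T \<Longrightarrow> C *\<^sub>v (transition_mat n A t *\<^sub>v x) = 0\<^sub>v k" for t
    proof (induction t rule: less_induct)
      case (less t)
      then show ?case
        using scaled_output_eq_0_iff[OF x, of t] L by simp
    qed
    then show ?R by blast
  next
    \<comment> \<open>In this direction the earlier outputs of the original system vanish by
      assumption.\<close>
    assume ?R
    then show ?L
      using scaled_output_eq_0_iff[OF x] by simp
  qed
  then show ?thesis
    using unobservable_subspace_eq[OF C S] unobservable_subspace_eq[OF C A] by auto
qed

end

theorem proposition2:
  fixes n T k :: nat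
    and A M :: "nat \<Rightarrow> real mat"
    and \<pi> :: "nat \<Rightarrow> nat"
    and C :: "real mat"
    and \<rho> l \<nu> :: "nat \<Rightarrow> real vec"
  assumes "n \<ge> 1" and "T \<ge> 1"
    and "\<forall>t<T. row_stochastic n (A t)"
    and "inj_on \<pi> {..<k}" and "\<pi> ` {..<k} \<subseteq> {..<n}"
    and "C = selection_mat n k \<pi>"
    and "\<forall>t\<le>T. \<rho> t \<in> carrier_vec k"
    and "primal_feasible n T C A \<rho> M"
    and "\<forall>t<T. \<forall>i<n. \<forall>j<n. A t $$ (i, j) > 0 \<longrightarrow> M t $$ (i, j) > 0"
    and "dual_optimal n T k C A \<rho> l \<nu>"
  shows "(observable n T k C (scaled_mat n T C A l \<nu>) \<longleftrightarrow> observable n T k C A)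
    \<and> unobservable_subspace n T k C (scaled_mat n T C A l \<nu>) = unobservable_subspace n T k C A"
proof -
  \<comment> \<open>Dual feasibility provides the dimensions of the multipliers, row stochasticity
    those of each \<open>A t\<close>.\<close>
  have "unobservable_subspace n T k C (scaled_mat n T C A l \<nu>) = unobservable_subspace n T k C A"
    using assms(3,5,6,10)
    by (intro unobservable_subspace_scaled_mat)
      (auto simp: row_stochastic_def dual_optimal_def dual_feasible_def)
  then show ?thesis
    by (simp add: observable_def)
qed

end
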